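(* Let $H$ be a Hopf $*$-algebra over $\mathbb{C}$. For any left $H$-modules $V,W$, the map $\rho_{VW}:\overline{V\otimes W}\to\overline W\otimes\overline V$ given by $\overline{v\otimes w}\mapsto\bar w\otimes\bar v$ is an isomorphism of $H$-modules. Given $H$-module maps $P:W\to Y$ and $T:X\to Z$, one has $$\rho_{YZ}\circ\overline{P\otimes T}=(\overline T\otimes\overline P)\circ\rho_{WX}$$ as maps $\overline{W\otimes X}\to\overline Z\otimes\overline Y$. Furthermore, for any left $H$-modules $U,V,W$, $$(\rho_{VW}\otimes\mathrm{id}_{\overline U})\circ\rho_{U,V\otimes W}=(\mathrm{id}_{\overline W}\otimes\rho_{UV})\circ\rho_{U\otimes V,W}$$ as maps $\overline{U\otimes V\otimes W}\to\overline W\otimes\overline V\otimes\overline U$.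
   Context: All vector spaces and tensor products are over $\mathbb{C}$, and associativity isomorphisms of tensor products are suppressed. A Hopf $*$-algebra is a Hopf algebra $H$ over $\mathbb{C}$ (coproduct $\Delta(a)=a_{(1)}\otimes a_{(2)}$, counit $\varepsilon$, antipode $S$) equipped with an antilinear map $*:H\to H$ such that $(a^* )^*=a$, $(ab)^*=b^*a^*$ and $\Delta(a^* )=a_{(1)}^*\otimes a_{(2)}^*$. The tensor product of $H$-modules has the action $a\rhd(v\otimes w)=(a_{(1)}\rhd v)\otimes(a_{(2)}\rhd w)$. For a vector space $V$, the complex conjugate vector space $\overline{V}$ consists of formal symbols $\bar v$ ($v\in V$) with $\bar v+\bar w=\overline{v+w}$ and $\lambda\cdot\bar v=\overline{\bar\lambda v}$. For a linear map $T:V\to W$, $\overline T(\bar v)=\overline{T(v)}$. If $V$ is a left $H$-module, $\overline V$ is a left $H$-module via $a\rhd\bar v=\overline{S(a)^*\rhd v}$. *)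

theory Defs
  imports Complex_Main "HOL-Library.Poly_Mapping"
begin

section \<open>Complex vector spaces and algebras\<close>

class scaleC =
  fixes scaleC :: "complex \<Rightarrow> 'a \<Rightarrow> 'a" (infixr \<open>*\<^sub>C\<close> 75)

class complex_vector = scaleC + ab_group_add +
  assumes scaleC_add_right: "a *\<^sub>C (x + y) = a *\<^sub>C x + a *\<^sub>C y"
    and scaleC_add_left: "(a + b) *\<^sub>C x = a *\<^sub>C x + b *\<^sub>C x"
    and scaleC_scaleC: "a *\<^sub>C b *\<^sub>C x = (a * b) *\<^sub>C x"
    and scaleC_one: "1 *\<^sub>C x = x"

text \<open>The condition \<open>0 \<noteq> 1\<close> contained in \<^class>\<open>ring_1\<close> excludes no Hopf algebra, because
  the counit maps \<open>1\<close> to \<open>1\<close>.\<close>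

class complex_algebra_1 = complex_vector + ring_1 +
  assumes mult_scaleC_left: "(a *\<^sub>C x) * y = a *\<^sub>C (x * y)"
    and mult_scaleC_right: "x * (a *\<^sub>C y) = a *\<^sub>C (x * y)"

global_interpretation complex_vector: vector_space "scaleC :: complex \<Rightarrow> 'a \<Rightarrow> 'a::complex_vector"
  by unfold_locales
    (simp_all add: scaleC_add_right scaleC_add_left scaleC_scaleC scaleC_one)

abbreviation clinear :: "('a::complex_vector \<Rightarrow> 'b::complex_vector) \<Rightarrow> bool" where
  "clinear \<equiv> Vector_Spaces.linear scaleC scaleC"

abbreviation antilinear :: "('a::complex_vector \<Rightarrow> 'b::complex_vector) \<Rightarrow> bool" where
  "antilinear \<equiv> Vector_Spaces.linear scaleC (\<lambda>c. scaleC (cnj c))"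

definition cbilinear ::
    "('a::complex_vector \<Rightarrow> 'b::complex_vector \<Rightarrow> 'c::complex_vector) \<Rightarrow> bool" where
  "cbilinear f \<longleftrightarrow> (\<forall>x. clinear (f x)) \<and> (\<forall>y. clinear (\<lambda>x. f x y))"

definition antibilinear ::
    "('a::complex_vector \<Rightarrow> 'b::complex_vector \<Rightarrow> 'c::complex_vector) \<Rightarrow> bool" where
  "antibilinear f \<longleftrightarrow> (\<forall>x. antilinear (f x)) \<and> (\<forall>y. antilinear (\<lambda>x. f x y))"

lemma clinear_iff:
  "clinear f \<longleftrightarrow> (\<forall>x y. f (x + y) = f x + f y) \<and> (\<forall>c x. f (c *\<^sub>C x) = c *\<^sub>C f x)"
  by (auto simp: Vector_Spaces.linear_iff complex_vector.vector_space_axioms)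

lemma vector_space_cnj: "vector_space (\<lambda>c. scaleC (cnj c) :: 'a::complex_vector \<Rightarrow> 'a)"
  by unfold_locales
    (simp_all add: scaleC_add_right scaleC_add_left scaleC_scaleC scaleC_one)

lemma antilinear_iff:
  "antilinear f \<longleftrightarrow> (\<forall>x y. f (x + y) = f x + f y) \<and> (\<forall>c x. f (c *\<^sub>C x) = cnj c *\<^sub>C f x)"
  by (auto simp: Vector_Spaces.linear_iff complex_vector.vector_space_axioms vector_space_cnj)

instantiation complex :: complex_vector
begin
definition scaleC_complex :: "complex \<Rightarrow> complex \<Rightarrow> complex" where
  "scaleC_complex = (*)"
instance
  by standard (simp_all add: scaleC_complex_def algebra_simps)
end

instantiation poly_mapping :: (type, complex_vector) complex_vector
begin
definition scaleC_poly_mapping :: "complex \<Rightarrow> ('a \<Rightarrow>\<^sub>0 'b) \<Rightarrow> 'a \<Rightarrow>\<^sub>0 'b" where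
  "scaleC_poly_mapping c = Poly_Mapping.map (scaleC c)"
lemma lookup_scaleC [simp]:
  "Poly_Mapping.lookup (c *\<^sub>C p) k = c *\<^sub>C Poly_Mapping.lookup p k"
  by (simp add: scaleC_poly_mapping_def map.rep_eq when_def)
instance
  by standard
    (simp_all add: poly_mapping_eq_iff fun_eq_iff lookup_add scaleC_add_right scaleC_add_left
      scaleC_scaleC scaleC_one)
end


section \<open>The complex conjugate vector space\<close>

datatype 'a conj_space = Bar (unbar: 'a)

instantiation conj_space :: (complex_vector) complex_vector
begin
definition "0 = Bar 0"
definition "x + y = Bar (unbar x + unbar y)"
definition "- x = Bar (- unbar x)"
definition "x - y = Bar (unbar x - unbar y)"
definition "c *\<^sub>C x = Bar (cnj c *\<^sub>C unbar x)"
instance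
  by standard
    (simp_all add: zero_conj_space_def plus_conj_space_def uminus_conj_space_def
      minus_conj_space_def scaleC_conj_space_def scaleC_add_right scaleC_add_left
      scaleC_scaleC scaleC_one algebra_simps)
end

definition conj_map :: "('a \<Rightarrow> 'b) \<Rightarrow> 'a conj_space \<Rightarrow> 'b conj_space" where
  "conj_map T x = Bar (T (unbar x))"

lemma antilinear_Bar: "antilinear Bar"
  by (simp add: antilinear_iff plus_conj_space_def scaleC_conj_space_def)

lemma antilinear_unbar: "antilinear unbar"
  by (simp add: antilinear_iff plus_conj_space_def scaleC_conj_space_def)


section \<open>The tensor product\<close>

text \<open>The free vector space on \<open>V \<times> W\<close> is \<^typ>\<open>('v \<times> 'w) \<Rightarrow>\<^sub>0 complex\<close>; the tensor product is its
  quotient by the span of the bilinearity relations.\<close>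

definition free_gen :: "'a \<Rightarrow> 'b \<Rightarrow> ('a \<times> 'b) \<Rightarrow>\<^sub>0 complex" where
  "free_gen a b = Poly_Mapping.single (a, b) 1"

definition tensor_relators :: "(('a::complex_vector \<times> 'b::complex_vector) \<Rightarrow>\<^sub>0 complex) set" where
  "tensor_relators =
     {free_gen (a + a') b - (free_gen a b + free_gen a' b) | a a' b. True} \<union>
     {free_gen a (b + b') - (free_gen a b + free_gen a b') | a b b'. True} \<union>
     {free_gen (c *\<^sub>C a) b - c *\<^sub>C free_gen a b | c a b. True} \<union>
     {free_gen a (c *\<^sub>C b) - c *\<^sub>C free_gen a b | c a b. True}"

definition tensor_rel ::
    "(('a::complex_vector \<times> 'b::complex_vector) \<Rightarrow>\<^sub>0 complex) \<Rightarrow> (('a \<times> 'b) \<Rightarrow>\<^sub>0 complex) \<Rightarrow> bool" where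
  "tensor_rel p q \<longleftrightarrow> p - q \<in> complex_vector.span tensor_relators"

lemma equivp_tensor_rel: "equivp tensor_rel"
proof (rule equivpI)
  show "reflp tensor_rel"
    by (simp add: reflp_def tensor_rel_def complex_vector.span_zero)
  show "symp tensor_rel"
    unfolding symp_def tensor_rel_def
    using complex_vector.span_neg by fastforce
  show "transp tensor_rel"
    unfolding transp_def tensor_rel_def
    using complex_vector.span_add by fastforce
qed

quotient_type (overloaded) ('a, 'b) tensor (infixr \<open>\<otimes>\<close> 70) =
  "('a::complex_vector \<times> 'b::complex_vector) \<Rightarrow>\<^sub>0 complex" / tensor_rel
  by (rule equivp_tensor_rel)

instantiation tensor :: (complex_vector, complex_vector) complex_vector
begin
lift_definition zero_tensor :: "'a \<otimes> 'b" is 0 .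
lift_definition plus_tensor :: "'a \<otimes> 'b \<Rightarrow> 'a \<otimes> 'b \<Rightarrow> 'a \<otimes> 'b" is "(+)"
  unfolding tensor_rel_def
  by (subst add_diff_add) (rule complex_vector.span_add)
lift_definition uminus_tensor :: "'a \<otimes> 'b \<Rightarrow> 'a \<otimes> 'b" is uminus
  unfolding tensor_rel_def by (subst minus_diff_minus) (rule complex_vector.span_neg)
lift_definition minus_tensor :: "'a \<otimes> 'b \<Rightarrow> 'a \<otimes> 'b \<Rightarrow> 'a \<otimes> 'b" is "(-)"
  unfolding tensor_rel_def
proof -
  fix p q r s :: "('a \<times> 'b) \<Rightarrow>\<^sub>0 complex"
  assume "p - q \<in> complex_vector.span tensor_relators" "r - s \<in> complex_vector.span tensor_relators"
  then have "(p - q) - (r - s) \<in> complex_vector.span tensor_relators"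
    by (rule complex_vector.span_diff)
  then show "(p - r) - (q - s) \<in> complex_vector.span tensor_relators"
    by (simp add: algebra_simps)
qed
lift_definition scaleC_tensor :: "complex \<Rightarrow> 'a \<otimes> 'b \<Rightarrow> 'a \<otimes> 'b" is scaleC
  unfolding tensor_rel_def
  by (subst complex_vector.scale_right_diff_distrib[symmetric]) (rule complex_vector.span_scale)
instance
proof
  fix x y z :: "'a \<otimes> 'b" and a b :: complex
  have eqI: "p = q \<Longrightarrow> tensor_rel p q" for p q :: "('a \<times> 'b) \<Rightarrow>\<^sub>0 complex"
    using equivp_reflp[OF equivp_tensor_rel] by simp
  show "x + y + z = x + (y + z)" by transfer (rule eqI, simp add: algebra_simps)
  show "x + y = y + x" by transfer (rule eqI, simp add: algebra_simps)
  show "0 + x = x" by transfer (rule eqI, simp)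
  show "- x + x = 0" by transfer (rule eqI, simp)
  show "x - y = x + - y" by transfer (rule eqI, simp)
  show "a *\<^sub>C (x + y) = a *\<^sub>C x + a *\<^sub>C y" by transfer (rule eqI, rule scaleC_add_right)
  show "(a + b) *\<^sub>C x = a *\<^sub>C x + b *\<^sub>C x" by transfer (rule eqI, rule scaleC_add_left)
  show "a *\<^sub>C b *\<^sub>C x = (a * b) *\<^sub>C x" by transfer (rule eqI, rule scaleC_scaleC)
  show "1 *\<^sub>C x = x" by transfer (rule eqI, rule scaleC_one)
qed
end

lift_definition tens :: "'a::complex_vector \<Rightarrow> 'b::complex_vector \<Rightarrow> 'a \<otimes> 'b" (infixr \<open>\<otimes>\<close> 70)
  is free_gen .

lemma cbilinear_tens: "cbilinear (\<otimes>)"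
proof -
  have rel: "p - q \<in> tensor_relators \<Longrightarrow> tensor_rel p q" for p q :: "('a \<times> 'b) \<Rightarrow>\<^sub>0 complex"
    by (simp add: tensor_rel_def complex_vector.span_base)
  have "(a + a') \<otimes> b = a \<otimes> b + a' \<otimes> b" for a a' :: 'a and b :: 'b
    by transfer (rule rel, unfold tensor_relators_def, blast)
  moreover have "a \<otimes> (b + b') = a \<otimes> b + a \<otimes> b'" for a :: 'a and b b' :: 'b
    by transfer (rule rel, unfold tensor_relators_def, blast)
  moreover have "(c *\<^sub>C a) \<otimes> b = c *\<^sub>C (a \<otimes> b)" for c and a :: 'a and b :: 'b
    by transfer (rule rel, unfold tensor_relators_def, blast)
  moreover have "a \<otimes> (c *\<^sub>C b) = c *\<^sub>C (a \<otimes> b)" for c and a :: 'a and b :: 'b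
    by transfer (rule rel, unfold tensor_relators_def, blast)
  ultimately show ?thesis
    by (simp add: cbilinear_def clinear_iff)
qed

lemma tensor_induct [case_names zero tens add, induct type: tensor]:
  assumes zero: "P 0" and tens: "\<And>a b. P (a \<otimes> b)"
    and add: "\<And>x y. P x \<Longrightarrow> P y \<Longrightarrow> P (x + y)"
  shows "P t"
proof -
  have single: "P (abs_tensor (Poly_Mapping.single k c))" for k c
  proof -
    obtain a b where k: "k = (a, b)" by (cases k)
    have "Poly_Mapping.single k c = c *\<^sub>C free_gen a b"
      by (simp add: poly_mapping_eq_iff fun_eq_iff free_gen_def k lookup_single when_def
          scaleC_complex_def)
    then have "abs_tensor (Poly_Mapping.single k c) = c *\<^sub>C (a \<otimes> b)"
      by (simp add: tens.abs_eq scaleC_tensor.abs_eq)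
    also have "\<dots> = (c *\<^sub>C a) \<otimes> b"
      using cbilinear_tens[where 'a = 'a and 'b = 'b] by (simp add: cbilinear_def clinear_iff)
    finally show ?thesis by (simp add: tens)
  qed
  have "P (abs_tensor p)" for p
  proof (induction p rule: update_induct)
    case const
    then show ?case using zero by (simp add: zero_tensor_def)
  next
    case (update p k c)
    then have "Poly_Mapping.update k c p = p + Poly_Mapping.single k c"
      by (auto simp: poly_mapping_eq_iff fun_eq_iff lookup_update lookup_add lookup_single when_def
          in_keys_iff)
    then show ?case
      using add[OF update.IH single] by (simp add: plus_tensor.abs_eq)
  qed
  then show ?thesis by (induction t rule: tensor.abs_induct) simp
qed

text \<open>The (anti)linear extension of an (anti)bilinear map, see \<open>ex1_tensor_lift\<close> and
  \<open>ex1_tensor_antilift\<close>; for other arguments the value is unspecified.\<close>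

definition tensor_lift ::
    "('a::complex_vector \<Rightarrow> 'b::complex_vector \<Rightarrow> 'c::complex_vector) \<Rightarrow> 'a \<otimes> 'b \<Rightarrow> 'c" where
  "tensor_lift f = (THE g. clinear g \<and> (\<forall>a b. g (a \<otimes> b) = f a b))"

definition tensor_antilift ::
    "('a::complex_vector \<Rightarrow> 'b::complex_vector \<Rightarrow> 'c::complex_vector) \<Rightarrow> 'a \<otimes> 'b \<Rightarrow> 'c" where
  "tensor_antilift f = (THE g. antilinear g \<and> (\<forall>a b. g (a \<otimes> b) = f a b))"

lemma ex_tensor_lift:
  fixes f :: "'a::complex_vector \<Rightarrow> 'b::complex_vector \<Rightarrow> 'c::complex_vector"
  assumes "cbilinear f"
  shows "\<exists>g. clinear g \<and> (\<forall>a b. g (a \<otimes> b) = f a b)"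
proof -
  define F where
    "F p = (\<Sum>k\<in>Poly_Mapping.keys p. Poly_Mapping.lookup p k *\<^sub>C f (fst k) (snd k))"
    for p :: "('a \<times> 'b) \<Rightarrow>\<^sub>0 complex"
  have sup: "F p = (\<Sum>k\<in>A. Poly_Mapping.lookup p k *\<^sub>C f (fst k) (snd k))"
    if "finite A" "Poly_Mapping.keys p \<subseteq> A" for p A
    unfolding F_def using that
    by (intro sum.mono_neutral_left) (auto simp: in_keys_iff)
  have F_add: "F (p + q) = F p + F q" for p q
  proof -
    let ?A = "Poly_Mapping.keys p \<union> Poly_Mapping.keys q"
    have "Poly_Mapping.keys (p + q) \<subseteq> ?A" by (rule Poly_Mapping.keys_add)
    then show ?thesis
      by (simp add: sup[of ?A] lookup_add scaleC_add_left sum.distrib)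
  qed
  have F_scale: "F (c *\<^sub>C p) = c *\<^sub>C F p" for c p
  proof -
    have "Poly_Mapping.keys (c *\<^sub>C p) \<subseteq> Poly_Mapping.keys p"
      by (auto simp: in_keys_iff scaleC_complex_def)
    then show ?thesis
      by (simp add: sup[of "Poly_Mapping.keys p"] complex_vector.scale_sum_right scaleC_scaleC
          scaleC_complex_def)
  qed
  have F_lin: "clinear F"
    by (simp add: clinear_iff F_add F_scale)
  interpret F: Vector_Spaces.linear "scaleC :: _ \<Rightarrow> (('a \<times> 'b) \<Rightarrow>\<^sub>0 complex) \<Rightarrow> _" "scaleC :: _ \<Rightarrow> 'c \<Rightarrow> 'c" F
    by (rule F_lin)
  have F_gen: "F (free_gen a b) = f a b" for a b
    by (simp add: F_def free_gen_def scaleC_one)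
  have F_span: "F p = 0" if "p \<in> complex_vector.span tensor_relators" for p
  proof (rule F.eq_0_on_span[OF _ that])
    show "F q = 0" if "q \<in> tensor_relators" for q
      using that assms
      by (auto simp: tensor_relators_def F.diff F.add F.scale F_gen cbilinear_def clinear_iff)
  qed
  have F_rel: "F p = F q" if "tensor_rel p q" for p q
    using F_span[of "p - q"] that by (simp add: tensor_rel_def F.diff)
  define g where "g t = F (rep_tensor t)" for t :: "'a \<otimes> 'b"
  have g_abs: "g (abs_tensor p) = F p" for p
    unfolding g_def by (rule F_rel) (rule Quotient3_rep_abs[OF Quotient3_tensor], simp add:
        equivp_reflp[OF equivp_tensor_rel])
  have "g (x + y) = g x + g y" for x y
    by (induction x rule: tensor.abs_induct, induction y rule: tensor.abs_induct)
      (simp add: g_abs plus_tensor.abs_eq F_add)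
  moreover have "g (c *\<^sub>C x) = c *\<^sub>C g x" for c x
    by (induction x rule: tensor.abs_induct) (simp add: g_abs scaleC_tensor.abs_eq F_scale)
  moreover have "g (a \<otimes> b) = f a b" for a b
    by (simp add: tens.abs_eq g_abs F_gen)
  ultimately show ?thesis
    by (auto simp: clinear_iff)
qed

lemma additive_tensor_eqI:
  fixes g h :: "'a::complex_vector \<otimes> 'b::complex_vector \<Rightarrow> 'c::ab_group_add"
  assumes "\<And>x y. g (x + y) = g x + g y" "\<And>x y. h (x + y) = h x + h y"
    and "\<And>a b. g (a \<otimes> b) = h (a \<otimes> b)"
  shows "g = h"
proof
  fix t
  interpret g: additive g by unfold_locales (rule assms)
  interpret h: additive h by unfold_locales (rule assms)
  show "g t = h t"
    by (induction t) (simp_all add: g.zero h.zero assms)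
qed

lemma ex1_tensor_lift:
  assumes "cbilinear f"
  shows "\<exists>!g. clinear g \<and> (\<forall>a b. g (a \<otimes> b) = f a b)"
  using ex_tensor_lift[OF assms]
  by (rule ex_ex1I) (auto simp: clinear_iff intro!: additive_tensor_eqI)

lemma ex1_tensor_antilift:
  assumes "antibilinear f"
  shows "\<exists>!g. antilinear g \<and> (\<forall>a b. g (a \<otimes> b) = f a b)"
proof (rule ex_ex1I)
  have "cbilinear (\<lambda>a b. Bar (f a b))"
    using assms
    by (simp add: cbilinear_def antibilinear_def clinear_iff antilinear_iff plus_conj_space_def
        scaleC_conj_space_def)
  then obtain g where "clinear g" "\<And>a b. g (a \<otimes> b) = Bar (f a b)"
    using ex_tensor_lift by blast
  then have "antilinear (\<lambda>t. unbar (g t)) \<and> (\<forall>a b. unbar (g (a \<otimes> b)) = f a b)"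
    by (simp add: clinear_iff antilinear_iff plus_conj_space_def scaleC_conj_space_def)
  then show "\<exists>g. antilinear g \<and> (\<forall>a b. g (a \<otimes> b) = f a b)"
    by blast
qed (auto simp: antilinear_iff intro!: additive_tensor_eqI)

lemma
  assumes "cbilinear f"
  shows clinear_tensor_lift: "clinear (tensor_lift f)"
    and tensor_lift_tens: "tensor_lift f (a \<otimes> b) = f a b"
  using theI'[OF ex1_tensor_lift[OF assms]] by (auto simp: tensor_lift_def)

lemma
  assumes "antibilinear f"
  shows antilinear_tensor_antilift: "antilinear (tensor_antilift f)"
    and tensor_antilift_tens: "tensor_antilift f (a \<otimes> b) = f a b"
  using theI'[OF ex1_tensor_antilift[OF assms]] by (auto simp: tensor_antilift_def)

definition tensor_map ::
    "('a::complex_vector \<Rightarrow> 'c::complex_vector) \<Rightarrow> ('b::complex_vector \<Rightarrow> 'd::complex_vector)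
      \<Rightarrow> 'a \<otimes> 'b \<Rightarrow> 'c \<otimes> 'd" where
  "tensor_map P T = tensor_lift (\<lambda>a b. P a \<otimes> T b)"

lemma tensor_map_tens:
  assumes "clinear P" "clinear T"
  shows "tensor_map P T (a \<otimes> b) = P a \<otimes> T b"
  unfolding tensor_map_def
  using assms cbilinear_tens[where 'a = 'b and 'b = 'd]
  by (subst tensor_lift_tens) (simp_all add: cbilinear_def clinear_iff)

definition tensor_assoc ::
    "('a::complex_vector \<otimes> 'b::complex_vector) \<otimes> 'c::complex_vector \<Rightarrow> 'a \<otimes> ('b \<otimes> 'c)" where
  "tensor_assoc = tensor_lift (\<lambda>t c. tensor_lift (\<lambda>a b. a \<otimes> (b \<otimes> c)) t)"

lemma cbilinear_tensor_lift:
  assumes ab: "\<And>c. cbilinear (\<lambda>a b. f a b c)" and c: "\<And>a b. clinear (f a b)"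
  shows "cbilinear (\<lambda>t c. tensor_lift (\<lambda>a b. f a b c) t)"
proof -
  define g where "g = (\<lambda>c. tensor_lift (\<lambda>a b. f a b c))"
  have lin: "clinear (g c)" for c
    unfolding g_def by (rule clinear_tensor_lift[OF ab])
  have tens: "g c (a \<otimes> b) = f a b c" for a b c
    unfolding g_def by (rule tensor_lift_tens[OF ab])
  have "g (c + c') = (\<lambda>t. g c t + g c' t)" for c c'
    using lin c by (intro additive_tensor_eqI) (simp_all add: clinear_iff tens)
  moreover have "g (k *\<^sub>C c) = (\<lambda>t. k *\<^sub>C g c t)" for k c
    using lin c
    by (intro additive_tensor_eqI) (simp_all add: clinear_iff tens scaleC_add_right)
  ultimately have "cbilinear (\<lambda>t c. g c t)"
    using lin by (simp add: cbilinear_def clinear_iff)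
  then show ?thesis
    by (simp add: g_def)
qed

lemma
  fixes a :: "'a::complex_vector" and b :: "'b::complex_vector" and c :: "'c::complex_vector"
  shows clinear_tensor_assoc: "clinear (tensor_assoc :: ('a \<otimes> 'b) \<otimes> 'c \<Rightarrow> _)"
    and tensor_assoc_tens: "tensor_assoc ((a \<otimes> b) \<otimes> c) = a \<otimes> (b \<otimes> c)"
proof -
  have 1: "cbilinear (\<lambda>(a::'a) (b::'b). a \<otimes> (b \<otimes> c))" for c :: 'c
    using cbilinear_tens[where 'a = 'b and 'b = 'c] cbilinear_tens[where 'a = 'a and 'b = "'b \<otimes> 'c"]
    by (simp add: cbilinear_def clinear_iff)
  have 2: "clinear (\<lambda>c::'c. a \<otimes> (b \<otimes> c))" for a :: 'a and b :: 'b
    using cbilinear_tens[where 'a = 'b and 'b = 'c] cbilinear_tens[where 'a = 'a and 'b = "'b \<otimes> 'c"]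
    by (simp add: cbilinear_def clinear_iff)
  note bil = cbilinear_tensor_lift[of "\<lambda>a b c. a \<otimes> (b \<otimes> c)", OF 1 2]
  show "clinear (tensor_assoc :: ('a \<otimes> 'b) \<otimes> 'c \<Rightarrow> _)"
    unfolding tensor_assoc_def by (rule clinear_tensor_lift[OF bil])
  show "tensor_assoc ((a \<otimes> b) \<otimes> c) = a \<otimes> (b \<otimes> c)"
    unfolding tensor_assoc_def by (simp add: tensor_lift_tens[OF bil] tensor_lift_tens[OF 1])
qed

lemma bij_tensor_assoc:
  "bij (tensor_assoc ::
     ('a::complex_vector \<otimes> 'b::complex_vector) \<otimes> 'c::complex_vector \<Rightarrow> 'a \<otimes> ('b \<otimes> 'c))"
proof -
  note tens = cbilinear_tens[where 'a = 'a and 'b = 'b] cbilinear_tens[where 'a = "'a \<otimes> 'b" and 'b = 'c]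
    cbilinear_tens[where 'a = 'a and 'b = "'b \<otimes> 'c"] cbilinear_tens[where 'a = 'b and 'b = 'c]
  define h where "h = (\<lambda>(s :: 'b \<otimes> 'c) (a :: 'a). tensor_lift (\<lambda>b c. (a \<otimes> b) \<otimes> c) s)"
  have 1: "cbilinear (\<lambda>(b::'b) (c::'c). (a \<otimes> b) \<otimes> c)" for a :: 'a
    using tens by (simp add: cbilinear_def clinear_iff)
  have 2: "clinear (\<lambda>a::'a. (a \<otimes> b) \<otimes> c)" for b :: 'b and c :: 'c
    using tens by (simp add: cbilinear_def clinear_iff)
  have "cbilinear h"
    unfolding h_def using 1 2 by (rule cbilinear_tensor_lift)
  then have bil: "cbilinear (\<lambda>a s. h s a)"
    by (simp add: cbilinear_def)
  have inv_lin: "clinear (tensor_lift (\<lambda>a s. h s a))"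
    by (rule clinear_tensor_lift[OF bil])
  have inv_tens: "tensor_lift (\<lambda>a s. h s a) (a \<otimes> (b \<otimes> c)) = (a \<otimes> b) \<otimes> c" for a b c
    by (simp add: tensor_lift_tens[OF bil]) (simp add: h_def tensor_lift_tens[OF 1])
  note lin = inv_lin clinear_tensor_assoc[where 'a = 'a and 'b = 'b and 'c = 'c] tens
  show ?thesis
  proof (rule o_bij)
    have "tensor_lift (\<lambda>a s. h s a) (tensor_assoc (t \<otimes> c)) = t \<otimes> c" for t :: "'a \<otimes> 'b" and c :: 'c
    proof -
      have "(\<lambda>t. tensor_lift (\<lambda>a s. h s a) (tensor_assoc (t \<otimes> c))) = (\<lambda>t. t \<otimes> c)"
        using lin
        by (intro additive_tensor_eqI)
          (simp_all add: clinear_iff cbilinear_def inv_tens tensor_assoc_tens)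
      then show ?thesis by (rule fun_cong)
    qed
    then show "tensor_lift (\<lambda>a s. h s a) \<circ> (tensor_assoc :: ('a \<otimes> 'b) \<otimes> 'c \<Rightarrow> _) = id"
      using lin by (intro additive_tensor_eqI) (simp_all add: clinear_iff)
    have "tensor_assoc (tensor_lift (\<lambda>a s. h s a) (a \<otimes> s)) = a \<otimes> s" for a :: 'a and s :: "'b \<otimes> 'c"
    proof -
      have "(\<lambda>s. tensor_assoc (tensor_lift (\<lambda>a s. h s a) (a \<otimes> s))) = (\<lambda>s. a \<otimes> s)"
        using lin
        by (intro additive_tensor_eqI)
          (simp_all add: clinear_iff cbilinear_def inv_tens tensor_assoc_tens)
      then show ?thesis by (rule fun_cong)
    qed
    then show "(tensor_assoc :: ('a \<otimes> 'b) \<otimes> 'c \<Rightarrow> _) \<circ> tensor_lift (\<lambda>a s. h s a) = id"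
      using lin by (intro additive_tensor_eqI) (simp_all add: clinear_iff)
  qed
qed

definition tensor_times ::
    "'a::complex_algebra_1 \<otimes> 'b::complex_algebra_1 \<Rightarrow> 'a \<otimes> 'b \<Rightarrow> 'a \<otimes> 'b" where
  "tensor_times s t =
     tensor_lift (\<lambda>a b. tensor_lift (\<lambda>a' b'. (a * a') \<otimes> (b * b')) t) s"


section \<open>Hopf star-algebras and their modules\<close>

text \<open>A Sweedler expression \<open>F (a\<^sub>(\<^sub>1\<^sub>)) (a\<^sub>(\<^sub>2\<^sub>))\<close> with \<open>F\<close> (anti)bilinear is rendered as the
  (anti)linear extension of \<open>F\<close> applied to \<open>\<Delta> a\<close>.\<close>

locale hopf_algebra =
  fixes \<Delta> :: "'h::complex_algebra_1 \<Rightarrow> 'h \<otimes> 'h"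
    and \<epsilon> :: "'h \<Rightarrow> complex"
    and S :: "'h \<Rightarrow> 'h"
  assumes clinear_coproduct: "clinear \<Delta>"
    and clinear_counit: "clinear \<epsilon>"
    and clinear_antipode: "clinear S"
    and coassoc: "tensor_assoc (tensor_map \<Delta> id (\<Delta> a)) = tensor_map id \<Delta> (\<Delta> a)"
    and counit_left: "tensor_lift (\<lambda>x y. \<epsilon> x *\<^sub>C y) (\<Delta> a) = a"
    and counit_right: "tensor_lift (\<lambda>x y. \<epsilon> y *\<^sub>C x) (\<Delta> a) = a"
    and coproduct_mult: "\<Delta> (a * b) = tensor_times (\<Delta> a) (\<Delta> b)"
    and coproduct_one: "\<Delta> 1 = 1 \<otimes> 1"
    and counit_mult: "\<epsilon> (a * b) = \<epsilon> a * \<epsilon> b"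
    and counit_one: "\<epsilon> 1 = 1"
    and antipode_left: "tensor_lift (\<lambda>x y. S x * y) (\<Delta> a) = \<epsilon> a *\<^sub>C 1"
    and antipode_right: "tensor_lift (\<lambda>x y. x * S y) (\<Delta> a) = \<epsilon> a *\<^sub>C 1"

locale hopf_star_algebra = hopf_algebra \<Delta> \<epsilon> S
  for \<Delta> :: "'h::complex_algebra_1 \<Rightarrow> 'h \<otimes> 'h" and \<epsilon> S +
  fixes star :: "'h \<Rightarrow> 'h"
  assumes antilinear_star: "antilinear star"
    and star_star: "star (star a) = a"
    and star_mult: "star (a * b) = star b * star a"
    and coproduct_star: "\<Delta> (star a) = tensor_antilift (\<lambda>x y. star x \<otimes> star y) (\<Delta> a)"

locale hmodule =
  fixes act :: "'h::complex_algebra_1 \<Rightarrow> 'v::complex_vector \<Rightarrow> 'v"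
  assumes cbilinear_act: "cbilinear act"
    and act_one: "act 1 v = v"
    and act_mult: "act (a * b) v = act a (act b v)"

locale hmodule_hom = V: hmodule actV + W: hmodule actW
  for actV :: "'h::complex_algebra_1 \<Rightarrow> 'v::complex_vector \<Rightarrow> 'v"
    and actW :: "'h \<Rightarrow> 'w::complex_vector \<Rightarrow> 'w" +
  fixes f :: "'v \<Rightarrow> 'w"
  assumes clinear_hom: "clinear f"
    and hom_act: "f (actV a v) = actW a (f v)"

locale hmodule_iso = hmodule_hom +
  assumes bij_iso: "bij f"

definition tensor_act ::
    "('h::complex_algebra_1 \<Rightarrow> 'h \<otimes> 'h) \<Rightarrow> ('h \<Rightarrow> 'v::complex_vector \<Rightarrow> 'v)
      \<Rightarrow> ('h \<Rightarrow> 'w::complex_vector \<Rightarrow> 'w) \<Rightarrow> 'h \<Rightarrow> 'v \<otimes> 'w \<Rightarrow> 'v \<otimes> 'w" where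
  "tensor_act \<Delta> actV actW a t = tensor_lift (\<lambda>x y. tensor_map (actV x) (actW y) t) (\<Delta> a)"

definition conj_act ::
    "('h::complex_algebra_1 \<Rightarrow> 'h) \<Rightarrow> ('h \<Rightarrow> 'h) \<Rightarrow> ('h \<Rightarrow> 'v::complex_vector \<Rightarrow> 'v)
      \<Rightarrow> 'h \<Rightarrow> 'v conj_space \<Rightarrow> 'v conj_space" where
  "conj_act S star act a x = Bar (act (star (S a)) (unbar x))"

definition rho ::
    "('v::complex_vector \<otimes> 'w::complex_vector) conj_space \<Rightarrow> 'w conj_space \<otimes> 'v conj_space" where
  "rho x = tensor_antilift (\<lambda>v w. Bar w \<otimes> Bar v) (unbar x)"

lemma
  fixes v :: "'v::complex_vector" and w :: "'w::complex_vector"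
  shows clinear_rho: "clinear (rho :: ('v \<otimes> 'w) conj_space \<Rightarrow> _)"
    and rho_Bar: "rho (Bar (v \<otimes> w)) = Bar w \<otimes> Bar v"
proof -
  have bil: "antibilinear (\<lambda>(v::'v) (w::'w). Bar w \<otimes> Bar v)"
    using antilinear_Bar[where 'a = 'v] antilinear_Bar[where 'a = 'w]
      cbilinear_tens[where 'a = "'w conj_space" and 'b = "'v conj_space"]
    by (simp add: antibilinear_def cbilinear_def antilinear_iff clinear_iff)
  show "rho (Bar (v \<otimes> w)) = Bar w \<otimes> Bar v"
    by (simp add: rho_def tensor_antilift_tens[OF bil])
  show "clinear (rho :: ('v \<otimes> 'w) conj_space \<Rightarrow> _)"
    using antilinear_tensor_antilift[OF bil] antilinear_unbar[where 'a = "'v \<otimes> 'w"]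
    by (simp add: rho_def antilinear_iff clinear_iff)
qed

end

theory Submission
  imports Defs
begin

text \<open>Every map in sight is additive, so each equation only has to be compared on pure tensors, where
naturality of \<open>\<rho>\<close> and its compatibility with associativity are immediate; the map
\<open>Bar w \<otimes> Bar v \<mapsto> Bar (v \<otimes> w)\<close> is well defined and inverts \<open>\<rho>\<close>.

The content lies in the module structures. That \<open>a\<close> acts on a conjugate module through \<open>(S a)\<^sup>*\<close>
defines an action because both \<open>S\<close> and \<open>*\<close> reverse products, and \<open>\<rho>\<close> is equivariant because
\<open>\<Delta> ((S a)\<^sup>*) = (S a\<^sub>2)\<^sup>* \<otimes> (S a\<^sub>1)\<^sup>*\<close>: the antipode reverses the coproduct
just as \<open>\<rho>\<close> reverses the factors. The Hopf algebra axioms state neither \<open>S (a b) = S b S a\<close> nor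
\<open>\<Delta> (S a) = S a\<^sub>2 \<otimes> S a\<^sub>1\<close>. Both follow from one cancellation principle, \<open>cancel_right_action\<close>: if \<open>H\<close>
acts from the right on a space and \<open>F(a\<^sub>1) \<cdot> a\<^sub>2 = G(a)\<close> for all \<open>a\<close>, then \<open>F(a) = G(a\<^sub>1) \<cdot> S a\<^sub>2\<close>,
because \<open>F(a) = F(a\<^sub>1) \<cdot> (a\<^sub>2 S a\<^sub>3)\<close>.

Applying it one variable, respectively one tensor factor, at a time involves no coproduct other
than that of \<open>H\<close>: from
\<open>S(a\<^sub>1 b\<^sub>1) a\<^sub>2 b\<^sub>2 = \<epsilon>(a) \<epsilon>(b) 1\<close> one cancels \<open>b\<^sub>2\<close> and then \<open>a\<^sub>2\<close>, and from
\<open>\<Delta>(S a\<^sub>1) (a\<^sub>2 \<otimes> a\<^sub>3) = \<epsilon>(a) (1 \<otimes> 1)\<close> one cancels \<open>a\<^sub>3\<close> and then \<open>a\<^sub>2\<close>. The usual argument by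
uniqueness of convolution inverses would instead require the coalgebra and the algebra structure
of \<open>H \<otimes> H\<close>.\<close>

section \<open>Multilinear maps on tensor products\<close>

lemma clinear_add: "clinear f \<Longrightarrow> f (x + y) = f x + f y"
  by (simp add: clinear_iff)

lemma clinear_scaleC: "clinear f \<Longrightarrow> f (c *\<^sub>C x) = c *\<^sub>C f x"
  by (simp add: clinear_iff)

lemmas clinear_simps = clinear_add clinear_scaleC

lemma cbilinear_iff:
  "cbilinear f \<longleftrightarrow>
    (\<forall>x x' y. f (x + x') y = f x y + f x' y) \<and> (\<forall>x y y'. f x (y + y') = f x y + f x y') \<and>
    (\<forall>c x y. f (c *\<^sub>C x) y = c *\<^sub>C f x y) \<and> (\<forall>c x y. f x (c *\<^sub>C y) = c *\<^sub>C f x y)"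
  by (auto simp: cbilinear_def clinear_iff)

lemma tens_simps:
  fixes a a' :: "'a::complex_vector" and b b' :: "'b::complex_vector"
  shows
  "(a + a') \<otimes> b = a \<otimes> b + a' \<otimes> b" "a \<otimes> (b + b') = a \<otimes> b + a \<otimes> b'"
  "(c *\<^sub>C a) \<otimes> b = c *\<^sub>C (a \<otimes> b)" "a \<otimes> (c *\<^sub>C b) = c *\<^sub>C (a \<otimes> b)"
  using cbilinear_tens[where 'a = 'a and 'b = 'b] by (simp_all add: cbilinear_iff)

lemmas scaleC_simps = scaleC_add_right scaleC_scaleC mult_scaleC_left mult_scaleC_right

lemma clinear_tensor_eqI:
  assumes "clinear g" "clinear h" "\<And>a b. g (a \<otimes> b) = h (a \<otimes> b)"
  shows "g t = h t"
proof -
  have "g = h"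
    using assms by (intro additive_tensor_eqI) (simp_all add: clinear_iff)
  then show ?thesis by simp
qed

lemma clinear_tensor_lift_parameter:
  assumes "\<And>c. cbilinear (\<lambda>a b. f a b c)" "\<And>a b. clinear (f a b)"
  shows "clinear (\<lambda>c. tensor_lift (\<lambda>a b. f a b c) t)"
  using cbilinear_tensor_lift[of f, OF assms] by (simp add: cbilinear_def)

lemma clinear_apply_tensor_lift:
  assumes L: "clinear L" and f: "cbilinear f"
  shows "L (tensor_lift f t) = tensor_lift (\<lambda>a b. L (f a b)) t"
proof -
  have Lf: "cbilinear (\<lambda>a b. L (f a b))"
    using assms by (simp add: cbilinear_iff clinear_iff)
  show ?thesis
    using L clinear_tensor_lift[OF f] clinear_tensor_lift[OF Lf]
    by - (rule clinear_tensor_eqI[where t = t],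
      simp_all add: clinear_iff tensor_lift_tens[OF f] tensor_lift_tens[OF Lf])
qed

lemma clinear_tensor_map:
  assumes "clinear P" "clinear T"
  shows "clinear (tensor_map P T)"
  unfolding tensor_map_def using assms
  by (intro clinear_tensor_lift) (simp add: cbilinear_iff clinear_iff tens_simps)

section \<open>The product on a tensor product of algebras\<close>

lemma cbilinear_tensor_times_inner:
  fixes t :: "'a::complex_algebra_1 \<otimes> 'b::complex_algebra_1"
  shows "cbilinear (\<lambda>a b. tensor_lift (\<lambda>a' b'. (a * a') \<otimes> (b * b')) t)"
  unfolding cbilinear_def
  by (intro conjI allI; rule clinear_tensor_lift_parameter;
    simp add: cbilinear_iff clinear_iff tens_simps algebra_simps scaleC_simps)

lemma tensor_times_tens:
  fixes a a' :: "'a::complex_algebra_1" and b b' :: "'b::complex_algebra_1"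
  shows "tensor_times (a \<otimes> b) (a' \<otimes> b') = (a * a') \<otimes> (b * b')"
  unfolding tensor_times_def tensor_lift_tens[OF cbilinear_tensor_times_inner]
  by (rule tensor_lift_tens) (simp add: cbilinear_iff tens_simps algebra_simps scaleC_simps)

lemma cbilinear_tensor_times:
  "cbilinear (tensor_times :: 'a::complex_algebra_1 \<otimes> 'b::complex_algebra_1 \<Rightarrow> _)"
  unfolding tensor_times_def
  by (intro cbilinear_tensor_lift cbilinear_tensor_times_inner clinear_tensor_lift)
    (simp add: cbilinear_iff tens_simps algebra_simps scaleC_simps)

text \<open>The right actions of the two factors on \<open>A \<otimes> B\<close>, by multiplication with \<open>x \<otimes> 1\<close> and \<open>1 \<otimes> y\<close>. They
are defined by the universal property, so that the factor which is not multiplied can be any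
vector space.\<close>

definition right_mult_fst ::
    "'a::complex_algebra_1 \<otimes> 'b::complex_vector \<Rightarrow> 'a \<Rightarrow> 'a \<otimes> 'b" where
  "right_mult_fst t x = tensor_lift (\<lambda>a b. (a * x) \<otimes> b) t"

definition right_mult_snd ::
    "'a::complex_vector \<otimes> 'b::complex_algebra_1 \<Rightarrow> 'b \<Rightarrow> 'a \<otimes> 'b" where
  "right_mult_snd t y = tensor_lift (\<lambda>a b. a \<otimes> (b * y)) t"

lemma
  fixes x y :: "'a::complex_algebra_1" and b :: "'b::complex_vector"
  shows cbilinear_right_mult_fst: "cbilinear (right_mult_fst :: 'a \<otimes> 'b \<Rightarrow> _)"
    and right_mult_fst_tens: "right_mult_fst (a \<otimes> b) x = (a * x) \<otimes> b"
    and right_mult_fst_one: "right_mult_fst t (1::'a) = (t :: 'a \<otimes> 'b)"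
    and right_mult_fst_mult:
      "right_mult_fst (right_mult_fst t x) y = right_mult_fst (t :: 'a \<otimes> 'b) (x * y)"
proof -
  have bil: "cbilinear (\<lambda>(a::'a) (b::'b). (a * x) \<otimes> b)" for x
    by (simp add: cbilinear_iff tens_simps algebra_simps scaleC_simps)
  show R: "cbilinear (right_mult_fst :: 'a \<otimes> 'b \<Rightarrow> _)"
    unfolding right_mult_fst_def using bil
    by (rule cbilinear_tensor_lift) (simp add: clinear_iff tens_simps algebra_simps scaleC_simps)
  show T: "right_mult_fst (a \<otimes> b) x = (a * x) \<otimes> b" for a x :: 'a and b :: 'b
    by (simp add: right_mult_fst_def tensor_lift_tens[OF bil])
  show "right_mult_fst t (1::'a) = (t :: 'a \<otimes> 'b)"
    using R by - (rule clinear_tensor_eqI[of "\<lambda>t. right_mult_fst t 1" "\<lambda>t. t"],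
      simp_all add: clinear_iff cbilinear_iff T)
  show "right_mult_fst (right_mult_fst t x) y = right_mult_fst (t :: 'a \<otimes> 'b) (x * y)"
    using R by - (rule clinear_tensor_eqI[of "\<lambda>t. right_mult_fst (right_mult_fst t x) y"
        "\<lambda>t. right_mult_fst t (x * y)"],
      simp_all add: clinear_iff cbilinear_iff T mult.assoc)
qed

lemma
  fixes x y :: "'b::complex_algebra_1" and a :: "'a::complex_vector"
  shows cbilinear_right_mult_snd: "cbilinear (right_mult_snd :: 'a \<otimes> 'b \<Rightarrow> _)"
    and right_mult_snd_tens: "right_mult_snd (a \<otimes> b) x = a \<otimes> (b * x)"
    and right_mult_snd_one: "right_mult_snd t (1::'b) = (t :: 'a \<otimes> 'b)"
    and right_mult_snd_mult:
      "right_mult_snd (right_mult_snd t x) y = right_mult_snd (t :: 'a \<otimes> 'b) (x * y)"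
proof -
  have bil: "cbilinear (\<lambda>(a::'a) (b::'b). a \<otimes> (b * x))" for x
    by (simp add: cbilinear_iff tens_simps algebra_simps scaleC_simps)
  show R: "cbilinear (right_mult_snd :: 'a \<otimes> 'b \<Rightarrow> _)"
    unfolding right_mult_snd_def using bil
    by (rule cbilinear_tensor_lift) (simp add: clinear_iff tens_simps algebra_simps scaleC_simps)
  show T: "right_mult_snd (a \<otimes> b) x = a \<otimes> (b * x)" for b x :: 'b and a :: 'a
    by (simp add: right_mult_snd_def tensor_lift_tens[OF bil])
  show "right_mult_snd t (1::'b) = (t :: 'a \<otimes> 'b)"
    using R by - (rule clinear_tensor_eqI[of "\<lambda>t. right_mult_snd t 1" "\<lambda>t. t"],
      simp_all add: clinear_iff cbilinear_iff T)
  show "right_mult_snd (right_mult_snd t x) y = right_mult_snd (t :: 'a \<otimes> 'b) (x * y)"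
    using R by - (rule clinear_tensor_eqI[of "\<lambda>t. right_mult_snd (right_mult_snd t x) y"
        "\<lambda>t. right_mult_snd t (x * y)"],
      simp_all add: clinear_iff cbilinear_iff T mult.assoc)
qed

text \<open>Multiplication by \<open>t\<close> splits into the two commuting right actions, which lets the factors of \<open>\<Delta> a\<close>
in a product \<open>s (\<Delta> a)\<close> be cancelled separately.\<close>

lemma tensor_times_eq_tensor_lift:
  fixes s t :: "'a::complex_algebra_1 \<otimes> 'b::complex_algebra_1"
  shows "tensor_times s t = tensor_lift (\<lambda>u v. right_mult_snd (right_mult_fst s u) v) t"
proof -
  note R = cbilinear_right_mult_fst[where 'a = 'a and 'b = 'b]
    cbilinear_right_mult_snd[where 'a = 'a and 'b = 'b]
  have bil: "cbilinear (\<lambda>u v. right_mult_snd (right_mult_fst s u) v)" for s :: "'a \<otimes> 'b"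
    using R by (simp add: cbilinear_iff)
  have par: "clinear (\<lambda>s :: 'a \<otimes> 'b. right_mult_snd (right_mult_fst s u) v)" for u v
    using R by (simp add: cbilinear_iff clinear_iff)
  have "tensor_times s (u \<otimes> v) = right_mult_snd (right_mult_fst s u) v" for u v
    using cbilinear_tensor_times[where 'a = 'a and 'b = 'b] par
    by - (rule clinear_tensor_eqI[of "\<lambda>s. tensor_times s (u \<otimes> v)"],
      simp_all add: cbilinear_def tensor_times_tens right_mult_fst_tens right_mult_snd_tens)
  then show ?thesis
    using cbilinear_tensor_times[where 'a = 'a and 'b = 'b]
    by - (rule clinear_tensor_eqI[of "tensor_times s"],
      simp_all add: cbilinear_def clinear_tensor_lift[OF bil] tensor_lift_tens[OF bil])
qed

section \<open>The antipode reverses products and coproducts\<close>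

context hopf_algebra
begin

lemma counit_simps: "\<epsilon> (x + y) = \<epsilon> x + \<epsilon> y" "\<epsilon> (c *\<^sub>C x) = c * \<epsilon> x"
  using clinear_simps[OF clinear_counit] by (simp_all add: scaleC_complex_def)

text \<open>The Sweedler form of coassociativity: both sides are \<open>F a\<^sub>1 a\<^sub>2 a\<^sub>3\<close>. It results from applying the
linear extension of \<open>F\<close> to the threefold tensor product to both sides of \<open>coassoc\<close>.\<close>

lemma coassoc_trilinear:
  fixes F :: "'h \<Rightarrow> 'h \<Rightarrow> 'h \<Rightarrow> 'v::complex_vector"
  assumes xy: "\<And>z. cbilinear (\<lambda>x y. F x y z)" and z: "\<And>x y. clinear (F x y)"
  shows "tensor_lift (\<lambda>x z. tensor_lift (\<lambda>x y. F x y z) (\<Delta> x)) (\<Delta> a) =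
    tensor_lift (\<lambda>x y. tensor_lift (F x) (\<Delta> y)) (\<Delta> a)"
proof -
  have yz: "cbilinear (F x)" for x
    using xy z by (simp add: cbilinear_iff clinear_iff)
  have K: "cbilinear (\<lambda>x. tensor_lift (F x))"
    unfolding cbilinear_def using xy yz
    by (intro conjI allI clinear_tensor_lift clinear_tensor_lift_parameter)
      (simp_all add: cbilinear_def)
  define k where "k = tensor_lift (\<lambda>x. tensor_lift (F x))"
  have k: "clinear k" "k (x \<otimes> s) = tensor_lift (F x) s" for x s
    unfolding k_def by (rule clinear_tensor_lift[OF K], rule tensor_lift_tens[OF K])
  have ka: "k (tensor_assoc (s \<otimes> z)) = tensor_lift (\<lambda>x y. F x y z) s" for s z
    using k(1) clinear_tensor_assoc[where 'a = 'h and 'b = 'h and 'c = 'h]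
    by - (rule clinear_tensor_eqI[of "\<lambda>s. k (tensor_assoc (s \<otimes> z))"],
      simp_all add: clinear_iff tens_simps clinear_simps[OF clinear_tensor_lift[OF xy]] tensor_assoc_tens k(2) tensor_lift_tens[OF yz]
        tensor_lift_tens[OF xy])
  have id: "clinear (id :: 'h \<Rightarrow> 'h)"
    by (simp add: clinear_iff)
  have "k (tensor_assoc (tensor_map \<Delta> id (\<Delta> a))) =
      tensor_lift (\<lambda>x z. tensor_lift (\<lambda>x y. F x y z) (\<Delta> x)) (\<Delta> a)"
    unfolding tensor_map_def
    using k(1) clinear_tensor_assoc[where 'a = 'h and 'b = 'h and 'c = 'h] clinear_coproduct
    by (subst clinear_apply_tensor_lift[of "\<lambda>s. k (tensor_assoc s)"])
      (simp_all add: clinear_iff cbilinear_iff tens_simps ka)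
  moreover have "k (tensor_map id \<Delta> (\<Delta> a)) = tensor_lift (\<lambda>x y. tensor_lift (F x) (\<Delta> y)) (\<Delta> a)"
    unfolding tensor_map_def using k(1) clinear_coproduct
    by (subst clinear_apply_tensor_lift[of k])
      (simp_all add: clinear_iff cbilinear_iff tens_simps k(2))
  ultimately show ?thesis
    by (simp add: coassoc)
qed

text \<open>In Sweedler notation,
\<open>F(a) = F(a\<^sub>1 \<epsilon>(a\<^sub>2)) = F(a\<^sub>1) \<cdot> (a\<^sub>2 S a\<^sub>3) = (F(a\<^sub>1) \<cdot> a\<^sub>2) \<cdot> S a\<^sub>3 = G(a\<^sub>1) \<cdot> S a\<^sub>2\<close>, with \<open>v \<cdot> x\<close> for \<open>r v x\<close>.
Thus acting by the antipode undoes acting by the second leg of the coproduct.\<close>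

lemma cancel_right_action:
  fixes r :: "'v::complex_vector \<Rightarrow> 'h \<Rightarrow> 'v"
  assumes r: "cbilinear r" and r_one: "\<And>v. r v 1 = v"
    and r_mult: "\<And>v x y. r (r v x) y = r v (x * y)"
    and F: "clinear F"
    and G: "\<And>a. tensor_lift (\<lambda>x y. r (F x) y) (\<Delta> a) = G a"
  shows "F a = tensor_lift (\<lambda>x y. r (G x) (S y)) (\<Delta> a)"
proof -
  note lin = r F clinear_antipode
  have "F a = tensor_lift (\<lambda>x y. F (\<epsilon> y *\<^sub>C x)) (\<Delta> a)"
    using lin by (subst clinear_apply_tensor_lift[of F, symmetric])
      (simp_all add: counit_right cbilinear_iff clinear_iff scaleC_simps scaleC_add_left
        counit_simps mult.commute)
  also have "\<dots> = tensor_lift (\<lambda>x y. tensor_lift (\<lambda>u v. r (F x) (u * S v)) (\<Delta> y)) (\<Delta> a)"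
  proof -
    have "F (\<epsilon> y *\<^sub>C x) = tensor_lift (\<lambda>u v. r (F x) (u * S v)) (\<Delta> y)" for x y
    proof -
      have "F (\<epsilon> y *\<^sub>C x) = r (F x) (tensor_lift (\<lambda>u v. u * S v) (\<Delta> y))"
        using lin by (simp add: antipode_right cbilinear_iff clinear_iff r_one)
      also have "\<dots> = tensor_lift (\<lambda>u v. r (F x) (u * S v)) (\<Delta> y)"
        using lin by - (rule clinear_apply_tensor_lift,
          simp_all add: cbilinear_iff clinear_iff algebra_simps scaleC_simps)
      finally show ?thesis .
    qed
    then show ?thesis by simp
  qed
  also have "\<dots> = tensor_lift (\<lambda>x z. tensor_lift (\<lambda>x y. r (F x) (y * S z)) (\<Delta> x)) (\<Delta> a)"
    using lin by (intro coassoc_trilinear[symmetric])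
      (simp_all add: cbilinear_iff clinear_iff algebra_simps scaleC_simps)
  also have "\<dots> = tensor_lift (\<lambda>x y. r (G x) (S y)) (\<Delta> a)"
  proof -
    have "tensor_lift (\<lambda>x y. r (F x) (y * S z)) (\<Delta> x) = r (G x) (S z)" for x z
      unfolding G[symmetric] r_mult[symmetric] using lin
      by - (rule clinear_apply_tensor_lift[of "\<lambda>v. r v (S z)", symmetric],
        simp_all add: cbilinear_iff clinear_iff)
    then show ?thesis by simp
  qed
  finally show ?thesis .
qed

text \<open>The case \<open>G(a) = \<epsilon>(a) c\<close>, in which the remaining coproduct collapses. For \<open>r\<close> the multiplication
and \<open>c = 1\<close> this is uniqueness of the antipode.\<close>

lemma cancel_right_action_counit:
  fixes r :: "'v::complex_vector \<Rightarrow> 'h \<Rightarrow> 'v"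
  assumes r: "cbilinear r" and r_one: "\<And>v. r v 1 = v"
    and r_mult: "\<And>v x y. r (r v x) y = r v (x * y)"
    and F: "clinear F"
    and G: "\<And>a. tensor_lift (\<lambda>x y. r (F x) y) (\<Delta> a) = \<epsilon> a *\<^sub>C c"
  shows "F a = r c (S a)"
proof -
  note lin = r clinear_antipode
  have "F a = tensor_lift (\<lambda>x y. r (\<epsilon> x *\<^sub>C c) (S y)) (\<Delta> a)"
    using assms by (rule cancel_right_action)
  also have "\<dots> = tensor_lift (\<lambda>x y. r c (S (\<epsilon> x *\<^sub>C y))) (\<Delta> a)"
    using lin by (simp add: cbilinear_iff clinear_iff)
  also have "\<dots> = r c (S (tensor_lift (\<lambda>x y. \<epsilon> x *\<^sub>C y) (\<Delta> a)))"
    using lin by - (rule clinear_apply_tensor_lift[of "\<lambda>y. r c (S y)", symmetric],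
      simp_all add: cbilinear_iff clinear_iff scaleC_simps scaleC_add_left
        counit_simps mult.commute)
  finally show ?thesis
    by (simp add: counit_left)
qed

lemma cbilinear_mult: "cbilinear ((*) :: 'h \<Rightarrow> 'h \<Rightarrow> 'h)"
  by (simp add: cbilinear_iff algebra_simps scaleC_simps)

lemma antipode_one: "S 1 = 1"
proof -
  have "cbilinear (\<lambda>x y. S x * y)"
    using clinear_antipode by (simp add: cbilinear_iff clinear_iff algebra_simps scaleC_simps)
  then show ?thesis
    using antipode_left[of 1] by (simp add: coproduct_one tensor_lift_tens counit_one scaleC_one)
qed

text \<open>Cancellation in \<open>b\<close> with \<open>a\<close> fixed: the antipode axiom for \<open>a b\<close> reads
\<open>(S(a\<^sub>1 b\<^sub>1) a\<^sub>2) b\<^sub>2 = \<epsilon>(b) \<epsilon>(a) 1\<close>, so the bracket, as a function of \<open>b\<close>, is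
\<open>\<epsilon>(a) S b\<close>.\<close>

lemma antipode_mult_convolution: "tensor_lift (\<lambda>x y. S (x * b) * y) (\<Delta> a) = \<epsilon> a *\<^sub>C S b"
proof -
  have bil: "cbilinear (\<lambda>x y. S (x * b) * y)" for b
    using clinear_antipode by (simp add: cbilinear_iff clinear_iff algebra_simps scaleC_simps)
  have bil': "cbilinear (\<lambda>x y. S x * y)"
    using clinear_antipode by (simp add: cbilinear_iff clinear_iff algebra_simps scaleC_simps)
  have par: "clinear (\<lambda>b. tensor_lift (\<lambda>x y. S (x * b) * y) s)" for s
    using clinear_antipode
    by (intro clinear_tensor_lift_parameter bil)
      (simp add: clinear_iff algebra_simps scaleC_simps)
  have bil2: "cbilinear (\<lambda>u v. tensor_lift (\<lambda>x y. S (x * u) * y) s * v)" for s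
    using par[of s] by (simp add: cbilinear_iff clinear_iff algebra_simps scaleC_simps)
  note TT = cbilinear_tensor_times[where 'a = 'h and 'b = 'h]
  have times: "tensor_lift (\<lambda>x y. S x * y) (tensor_times s t) =
      tensor_lift (\<lambda>u v. tensor_lift (\<lambda>x y. S (x * u) * y) s * v) t" for s t
  proof -
    have "tensor_lift (\<lambda>x y. S x * y) (tensor_times s (u \<otimes> v)) =
        tensor_lift (\<lambda>x y. S (x * u) * y) s * v" for u v
      using TT clinear_tensor_lift[OF bil']
      by - (rule clinear_tensor_eqI[of "\<lambda>s. tensor_lift (\<lambda>x y. S x * y) (tensor_times s (u \<otimes> v))"],
        simp_all add: cbilinear_iff clinear_iff tensor_times_tens tensor_lift_tens[OF bil]
          clinear_simps[OF clinear_tensor_lift[OF bil]]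
          tensor_lift_tens[OF bil'] algebra_simps scaleC_simps)
    then show ?thesis
      using TT clinear_tensor_lift[OF bil']
      by - (rule clinear_tensor_eqI[of "\<lambda>t. tensor_lift (\<lambda>x y. S x * y) (tensor_times s t)"],
        simp_all add: cbilinear_iff clinear_iff clinear_simps[OF clinear_tensor_lift[OF bil2]] tensor_lift_tens[OF bil2])
  qed
  have "tensor_lift (\<lambda>x y. S (x * b) * y) (\<Delta> a) = (\<epsilon> a *\<^sub>C 1) * S b"
  proof (rule cancel_right_action_counit[of "(*)"])
    show "tensor_lift (\<lambda>u v. tensor_lift (\<lambda>x y. S (x * u) * y) (\<Delta> a) * v) (\<Delta> b) =
        \<epsilon> b *\<^sub>C (\<epsilon> a *\<^sub>C 1)" for b
      using antipode_left[of "a * b"]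
      by (simp add: coproduct_mult times counit_mult scaleC_scaleC mult.commute)
  qed (simp_all add: cbilinear_mult par mult.assoc)
  then show ?thesis
    by (simp add: scaleC_simps)
qed

text \<open>Now cancellation in \<open>a\<close> with \<open>b\<close> fixed, since \<open>S(a\<^sub>1 b) a\<^sub>2 = \<epsilon>(a) S b\<close>.\<close>

lemma antipode_mult: "S (a * b) = S b * S a"
proof (rule cancel_right_action_counit[of "(*)" "\<lambda>a. S (a * b)"])
  show "clinear (\<lambda>a. S (a * b))"
    using clinear_antipode by (simp add: clinear_iff algebra_simps scaleC_simps)
qed (simp_all add: cbilinear_mult antipode_mult_convolution mult.assoc)

text \<open>Cancellation in the second tensor factor: by coassociativity,
\<open>(\<Delta>(S a\<^sub>1) (a\<^sub>2 \<otimes> 1)) (1 \<otimes> a\<^sub>3) = \<Delta>(S a\<^sub>1) \<Delta>(a\<^sub>2) = \<Delta>(S a\<^sub>1 a\<^sub>2) = \<epsilon>(a) (1 \<otimes> 1)\<close>.\<close>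

lemma coproduct_antipode_convolution:
  "tensor_lift (\<lambda>x y. right_mult_fst (\<Delta> (S x)) y) (\<Delta> a) = 1 \<otimes> S a"
proof -
  note lin = cbilinear_right_mult_fst[where 'a = 'h and 'b = 'h]
    cbilinear_right_mult_snd[where 'a = 'h and 'b = 'h] clinear_antipode clinear_coproduct
  have bil: "cbilinear (\<lambda>x y. right_mult_fst (\<Delta> (S x)) y)"
    using lin by (simp add: cbilinear_iff clinear_iff)
  have conv: "tensor_lift (\<lambda>x z. right_mult_snd
      (tensor_lift (\<lambda>x y. right_mult_fst (\<Delta> (S x)) y) (\<Delta> x)) z) (\<Delta> a) = \<epsilon> a *\<^sub>C (1 \<otimes> 1)" for a
  proof -
    have "right_mult_snd (tensor_lift (\<lambda>x y. right_mult_fst (\<Delta> (S x)) y) (\<Delta> x)) z =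
        tensor_lift (\<lambda>x y. right_mult_snd (right_mult_fst (\<Delta> (S x)) y) z) (\<Delta> x)" for x z
      using lin bil by - (rule clinear_apply_tensor_lift[of "\<lambda>t. right_mult_snd t z"],
        simp_all add: cbilinear_iff clinear_iff)
    then have "tensor_lift (\<lambda>x z. right_mult_snd
        (tensor_lift (\<lambda>x y. right_mult_fst (\<Delta> (S x)) y) (\<Delta> x)) z) (\<Delta> a) =
        tensor_lift (\<lambda>x z. tensor_lift
          (\<lambda>x y. right_mult_snd (right_mult_fst (\<Delta> (S x)) y) z) (\<Delta> x)) (\<Delta> a)"
      by simp
    also have "\<dots> = tensor_lift (\<lambda>x y. tensor_lift
          (\<lambda>y z. right_mult_snd (right_mult_fst (\<Delta> (S x)) y) z) (\<Delta> y)) (\<Delta> a)"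
      using lin by (intro coassoc_trilinear) (simp_all add: cbilinear_iff clinear_iff)
    also have "\<dots> = tensor_lift (\<lambda>x y. \<Delta> (S x * y)) (\<Delta> a)"
      by (simp add: coproduct_mult tensor_times_eq_tensor_lift)
    also have "\<dots> = \<Delta> (tensor_lift (\<lambda>x y. S x * y) (\<Delta> a))"
      using lin by - (rule clinear_apply_tensor_lift[symmetric],
        simp_all add: cbilinear_iff clinear_iff algebra_simps scaleC_simps)
    finally show ?thesis
      using clinear_coproduct by (simp add: antipode_left clinear_scaleC coproduct_one)
  qed
  have "tensor_lift (\<lambda>x y. right_mult_fst (\<Delta> (S x)) y) (\<Delta> a) = right_mult_snd (1 \<otimes> 1) (S a)"
  proof (rule cancel_right_action_counit[of right_mult_snd])
    show "clinear (\<lambda>a. tensor_lift (\<lambda>x y. right_mult_fst (\<Delta> (S x)) y) (\<Delta> a))"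
      using clinear_tensor_lift[OF bil] clinear_coproduct by (simp add: clinear_iff)
  qed (simp_all add: cbilinear_right_mult_snd right_mult_snd_one right_mult_snd_mult conv)
  then show ?thesis
    by (simp add: right_mult_snd_tens)
qed

text \<open>Cancellation in the first tensor factor turns \<open>\<Delta>(S a\<^sub>1) (a\<^sub>2 \<otimes> 1) = 1 \<otimes> S a\<close> into
\<open>\<Delta>(S a) = (1 \<otimes> S a\<^sub>1) (S a\<^sub>2 \<otimes> 1)\<close>.\<close>

lemma coproduct_antipode: "\<Delta> (S a) = tensor_lift (\<lambda>x y. S y \<otimes> S x) (\<Delta> a)"
proof -
  have "\<Delta> (S a) = tensor_lift (\<lambda>x y. right_mult_fst (1 \<otimes> S x) (S y)) (\<Delta> a)"
  proof (rule cancel_right_action[of right_mult_fst "\<lambda>a. \<Delta> (S a)"])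
    show "clinear (\<lambda>a. \<Delta> (S a))"
      using clinear_coproduct clinear_antipode by (simp add: clinear_iff)
  qed (simp_all add: cbilinear_right_mult_fst right_mult_fst_one right_mult_fst_mult
      coproduct_antipode_convolution)
  then show ?thesis
    by (simp add: right_mult_fst_tens)
qed

end

section \<open>Tensor products and conjugates of modules\<close>

text \<open>The action of \<open>A \<otimes> B\<close> on \<open>V \<otimes> W\<close>, of which the action of a Hopf algebra on \<open>V \<otimes> W\<close> is the pullback
along \<open>\<Delta>\<close>. Identities that hold for \<open>\<Delta> a\<close> are proved for all elements of \<open>A \<otimes> B\<close>, where it is
enough to consider pure tensors.\<close>

definition tensor_algebra_act ::
    "('a::complex_vector \<Rightarrow> 'v::complex_vector \<Rightarrow> 'v) \<Rightarrow> ('b::complex_vector \<Rightarrow> 'w::complex_vector \<Rightarrow> 'w)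
      \<Rightarrow> 'a \<otimes> 'b \<Rightarrow> 'v \<otimes> 'w \<Rightarrow> 'v \<otimes> 'w" where
  "tensor_algebra_act actV actW s t = tensor_lift (\<lambda>x y. tensor_map (actV x) (actW y) t) s"

lemma tensor_act_eq: "tensor_act \<Delta> actV actW a = tensor_algebra_act actV actW (\<Delta> a)"
  by (simp add: fun_eq_iff tensor_act_def tensor_algebra_act_def)

lemma
  fixes actV :: "'a::complex_vector \<Rightarrow> 'v::complex_vector \<Rightarrow> 'v"
    and actW :: "'b::complex_vector \<Rightarrow> 'w::complex_vector \<Rightarrow> 'w"
  assumes V: "cbilinear actV" and W: "cbilinear actW"
  shows cbilinear_tensor_algebra_act: "cbilinear (tensor_algebra_act actV actW)"
    and tensor_algebra_act_tens:
      "tensor_algebra_act actV actW (x \<otimes> y) (v \<otimes> w) = actV x v \<otimes> actW y w"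
proof -
  have lin: "clinear (actV x)" "clinear (actW y)" for x y
    using V W by (simp_all add: cbilinear_def)
  have bil: "cbilinear (\<lambda>x y. tensor_map (actV x) (actW y) t)" for t
    unfolding cbilinear_def tensor_map_def
    by (intro conjI allI; rule clinear_tensor_lift_parameter)
      (use V W in \<open>simp_all add: cbilinear_iff clinear_iff tens_simps\<close>)
  show "cbilinear (tensor_algebra_act actV actW)"
    unfolding tensor_algebra_act_def using bil clinear_tensor_map[OF lin]
    by (rule cbilinear_tensor_lift)
  show "tensor_algebra_act actV actW (x \<otimes> y) (v \<otimes> w) = actV x v \<otimes> actW y w"
    unfolding tensor_algebra_act_def tensor_lift_tens[OF bil] by (rule tensor_map_tens[OF lin])
qed

lemma tensor_algebra_act_times:
  fixes actV :: "'h::complex_algebra_1 \<Rightarrow> 'v::complex_vector \<Rightarrow> 'v"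
    and actW :: "'h \<Rightarrow> 'w::complex_vector \<Rightarrow> 'w"
  assumes "hmodule actV" "hmodule actW"
  shows "tensor_algebra_act actV actW (tensor_times s s') t =
    tensor_algebra_act actV actW s (tensor_algebra_act actV actW s' t)"
proof -
  interpret V: hmodule actV by fact
  interpret W: hmodule actW by fact
  let ?A = "tensor_algebra_act actV actW"
  note A = cbilinear_tensor_algebra_act[OF V.cbilinear_act W.cbilinear_act]
  note A_tens = tensor_algebra_act_tens[OF V.cbilinear_act W.cbilinear_act]
  note bil = A cbilinear_tensor_times[where 'a = 'h and 'b = 'h]
  have 1: "?A (tensor_times (x \<otimes> y) (x' \<otimes> y')) t = ?A (x \<otimes> y) (?A (x' \<otimes> y') t)" for x y x' y' t
    using A
    by - (rule clinear_tensor_eqI[where t = t],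
      simp_all add: cbilinear_iff clinear_iff A_tens tensor_times_tens V.act_mult W.act_mult)
  have 2: "?A (tensor_times (x \<otimes> y) s') t = ?A (x \<otimes> y) (?A s' t)" for x y s'
    using bil
    by - (rule clinear_tensor_eqI[where t = s'], simp_all add: cbilinear_iff clinear_iff 1)
  show ?thesis
    using bil
    by - (rule clinear_tensor_eqI[where t = s], simp_all add: cbilinear_iff clinear_iff 2)
qed

lemma (in hopf_algebra) hmodule_tensor_act:
  assumes "hmodule actV" "hmodule actW"
  shows "hmodule (tensor_act \<Delta> actV actW)"
proof -
  interpret V: hmodule actV by fact
  interpret W: hmodule actW by fact
  note A = cbilinear_tensor_algebra_act[OF V.cbilinear_act W.cbilinear_act]
  note A_tens = tensor_algebra_act_tens[OF V.cbilinear_act W.cbilinear_act]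
  show ?thesis
    unfolding tensor_act_eq
  proof
    show "cbilinear (\<lambda>a. tensor_algebra_act actV actW (\<Delta> a))"
      using A clinear_coproduct by (simp add: cbilinear_iff clinear_iff)
    show "tensor_algebra_act actV actW (\<Delta> 1) t = t" for t
      using A
      by - (rule clinear_tensor_eqI[where t = t],
        simp_all add: cbilinear_iff clinear_iff coproduct_one A_tens V.act_one W.act_one)
    show "tensor_algebra_act actV actW (\<Delta> (a * b)) t =
        tensor_algebra_act actV actW (\<Delta> a) (tensor_algebra_act actV actW (\<Delta> b) t)" for a b t
      by (simp add: coproduct_mult tensor_algebra_act_times assms)
  qed
qed

lemma Bar_simps: "Bar (x + y) = Bar x + Bar y" "Bar (c *\<^sub>C x) = cnj c *\<^sub>C Bar x"
  using antilinear_Bar unfolding antilinear_iff by blast+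

context hopf_star_algebra
begin

lemma star_one: "star 1 = 1"
  using star_mult[of 1 "star 1"] by (simp add: star_star)

lemma star_antipode_simps:
  "star (S (a + b)) = star (S a) + star (S b)"
  "star (S (c *\<^sub>C a)) = cnj c *\<^sub>C star (S a)"
  using antilinear_star by (simp_all add: clinear_simps[OF clinear_antipode] antilinear_iff)

lemma conj_act_Bar: "conj_act S star act a (Bar v) = Bar (act (star (S a)) v)"
  by (simp add: conj_act_def)

lemma hmodule_conj_act:
  assumes "hmodule act"
  shows "hmodule (conj_act S star act)"
proof -
  interpret hmodule act by fact
  show ?thesis
  proof
    show "cbilinear (conj_act S star act)"
      using cbilinear_act
      by (simp add: cbilinear_iff conj_act_def star_antipode_simps plus_conj_space_def
          scaleC_conj_space_def)
  qed (simp_all add: conj_act_def antipode_one star_one antipode_mult star_mult act_one act_mult)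
qed

text \<open>In Sweedler notation, \<open>\<Delta>((S a)\<^sup>*) = (S a\<^sub>2)\<^sup>* \<otimes> (S a\<^sub>1)\<^sup>*\<close>. The right-hand side is antilinear in \<open>a\<close>;
taking values in the conjugate space makes it linear, so that it is a \<open>tensor_lift\<close>.\<close>

lemma coproduct_star_antipode:
  "\<Delta> (star (S a)) =
    unbar (tensor_lift (\<lambda>x y. Bar (star (S y) \<otimes> star (S x))) (\<Delta> a))"
proof -
  let ?g = "tensor_antilift (\<lambda>x y. star x \<otimes> star y)"
  have bil: "antibilinear (\<lambda>x y. star x \<otimes> star y)"
    using antilinear_star by (simp add: antibilinear_def antilinear_iff tens_simps)
  have "Bar (?g (tensor_lift (\<lambda>x y. S y \<otimes> S x) (\<Delta> a))) =
      tensor_lift (\<lambda>x y. Bar (?g (S y \<otimes> S x))) (\<Delta> a)"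
    using antilinear_tensor_antilift[OF bil]
    by - (rule clinear_apply_tensor_lift[of "\<lambda>s. Bar (?g s)"],
      simp_all add: clinear_iff cbilinear_iff antilinear_iff Bar_simps tens_simps
        clinear_simps[OF clinear_antipode])
  then have "?g (tensor_lift (\<lambda>x y. S y \<otimes> S x) (\<Delta> a)) =
      unbar (tensor_lift (\<lambda>x y. Bar (?g (S y \<otimes> S x))) (\<Delta> a))"
    by (metis conj_space.sel)
  then show ?thesis
    by (simp add: coproduct_star coproduct_antipode tensor_antilift_tens[OF bil])
qed

section \<open>The flip of conjugates\<close>

text \<open>After \<open>coproduct_star_antipode\<close>, both sides make sense for an arbitrary tensor in place of \<open>\<Delta> a\<close>.
For \<open>x \<otimes> y\<close> acting on \<open>Bar (v \<otimes> w)\<close> both give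
\<open>Bar ((S x)\<^sup>* w) \<otimes> Bar ((S y)\<^sup>* v)\<close>.\<close>

lemma rho_conj_act:
  assumes "hmodule actV" "hmodule actW"
  shows "rho (conj_act S star (tensor_act \<Delta> actV actW) a x) =
    tensor_act \<Delta> (conj_act S star actW) (conj_act S star actV) a (rho x)"
proof -
  interpret V: hmodule actV by fact
  interpret W: hmodule actW by fact
  interpret V': hmodule "conj_act S star actV" by (rule hmodule_conj_act) fact
  interpret W': hmodule "conj_act S star actW" by (rule hmodule_conj_act) fact
  let ?A = "tensor_algebra_act actV actW"
  let ?B = "tensor_algebra_act (conj_act S star actW) (conj_act S star actV)"
  let ?g = "tensor_lift (\<lambda>x y. Bar (star (S y) \<otimes> star (S x)))"
  note A = cbilinear_tensor_algebra_act[OF V.cbilinear_act W.cbilinear_act]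
  note A_tens = tensor_algebra_act_tens[OF V.cbilinear_act W.cbilinear_act]
  note B = cbilinear_tensor_algebra_act[OF W'.cbilinear_act V'.cbilinear_act]
  note B_tens = tensor_algebra_act_tens[OF W'.cbilinear_act V'.cbilinear_act]
  have bil: "cbilinear (\<lambda>x y. Bar (star (S y) \<otimes> star (S x)))"
    by (simp add: cbilinear_iff star_antipode_simps Bar_simps tens_simps)
  have tens: "rho (Bar (?A (unbar (?g (x \<otimes> y))) t)) = ?B (x \<otimes> y) (rho (Bar t))" for x y t
    using A B
    by - (rule additive_tensor_eqI[THEN fun_cong, where x = t],
      simp_all add: cbilinear_iff Bar_simps clinear_simps[OF clinear_rho]
        tensor_lift_tens[OF bil] A_tens B_tens rho_Bar conj_act_Bar)
  have "rho (Bar (?A (unbar (?g s)) t)) = ?B s (rho (Bar t))" for s t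
    using A B antilinear_unbar[where 'a = "'h \<otimes> 'h"]
    by - (rule clinear_tensor_eqI[where t = s],
      simp_all add: cbilinear_iff clinear_iff antilinear_iff Bar_simps tens
        clinear_simps[OF clinear_rho] clinear_simps[OF clinear_tensor_lift[OF bil]])
  from this[of "\<Delta> a" "unbar x"] show ?thesis
    by (simp add: conj_act_def tensor_act_eq coproduct_star_antipode)
qed

end

lemma bij_rho:
  "bij (rho :: ('v::complex_vector \<otimes> 'w::complex_vector) conj_space \<Rightarrow> 'w conj_space \<otimes> 'v conj_space)"
proof -
  let ?f = "\<lambda>(x :: 'w conj_space) (y :: 'v conj_space). Bar (unbar y \<otimes> unbar x)"
  have bil: "cbilinear ?f"
    using antilinear_unbar[where 'a = 'v] antilinear_unbar[where 'a = 'w]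
    by (simp add: cbilinear_iff antilinear_iff tens_simps Bar_simps)
  note [simp] = clinear_simps[OF clinear_rho] clinear_simps[OF clinear_tensor_lift[OF bil]]
    rho_Bar tensor_lift_tens[OF bil]
  show ?thesis
  proof (rule o_bij)
    have inv: "tensor_lift ?f (rho (Bar t)) = Bar t" for t
      by (rule additive_tensor_eqI[THEN fun_cong, where x = t]) (simp_all add: Bar_simps)
    show "tensor_lift ?f \<circ> rho = id"
    proof
      fix x show "(tensor_lift ?f \<circ> rho) x = id x"
        using inv[of "unbar x"] by simp
    qed
    have "rho (tensor_lift ?f t) = t" for t
      by (rule clinear_tensor_eqI[where t = t]) (simp_all add: clinear_iff)
    then show "rho \<circ> tensor_lift ?f = id"
      by (simp add: fun_eq_iff)
  qed
qed

lemma (in hopf_star_algebra) hmodule_iso_rho: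
  assumes "hmodule actV" "hmodule actW"
  shows "hmodule_iso (conj_act S star (tensor_act \<Delta> actV actW))
    (tensor_act \<Delta> (conj_act S star actW) (conj_act S star actV)) rho"
  using assms
  by (intro hmodule_iso.intro hmodule_hom.intro hmodule_hom_axioms.intro hmodule_iso_axioms.intro
      hmodule_conj_act hmodule_tensor_act rho_conj_act clinear_rho bij_rho)

lemma conj_tensor_eqI:
  fixes g h :: "('a::complex_vector \<otimes> 'b::complex_vector) conj_space \<Rightarrow> 'c::complex_vector"
  assumes "clinear g" "clinear h" "\<And>a b. g (Bar (a \<otimes> b)) = h (Bar (a \<otimes> b))"
  shows "g = h"
proof
  fix x
  have "g (Bar t) = h (Bar t)" for t
    using assms
    by - (rule additive_tensor_eqI[THEN fun_cong, where x = t], simp_all add: clinear_iff Bar_simps)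
  from this[of "unbar x"] show "g x = h x"
    by simp
qed

lemma clinear_conj_map:
  assumes "clinear T"
  shows "clinear (conj_map T)"
  using assms
  by (simp add: clinear_iff conj_map_def plus_conj_space_def scaleC_conj_space_def)

lemma conj_map_Bar: "conj_map T (Bar v) = Bar (T v)"
  by (simp add: conj_map_def)

lemma clinear_comp: "clinear f \<Longrightarrow> clinear g \<Longrightarrow> clinear (g \<circ> f)"
  by (simp add: clinear_iff)

lemma clinear_id: "clinear id"
  by (simp add: clinear_iff)

lemma rho_natural:
  assumes P: "clinear P" and T: "clinear T"
  shows "rho \<circ> conj_map (tensor_map P T) = tensor_map (conj_map T) (conj_map P) \<circ> rho"
  by (rule conj_tensor_eqI)
    (simp_all add: clinear_comp clinear_rho clinear_conj_map clinear_tensor_map assms conj_map_Bar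
      rho_Bar tensor_map_tens)

lemma rho_assoc:
  "tensor_assoc \<circ>
    tensor_map (rho :: ('v::complex_vector \<otimes> 'w::complex_vector) conj_space \<Rightarrow> _)
      (id :: 'u::complex_vector conj_space \<Rightarrow> _) \<circ> rho \<circ> conj_map tensor_assoc =
   tensor_map id rho \<circ> rho"
proof (rule conj_tensor_eqI)
  let ?l = "tensor_assoc \<circ>
    tensor_map (rho :: ('v \<otimes> 'w) conj_space \<Rightarrow> _) (id :: 'u conj_space \<Rightarrow> _) \<circ> rho \<circ>
    conj_map tensor_assoc"
  let ?r = "tensor_map (id :: 'w conj_space \<Rightarrow> _) (rho :: ('u \<otimes> 'v) conj_space \<Rightarrow> _) \<circ> rho"
  show l: "clinear ?l" and r: "clinear ?r"
    by (intro clinear_comp clinear_tensor_map clinear_rho clinear_conj_map clinear_tensor_assoc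
        clinear_id)+
  show "?l (Bar (s \<otimes> w)) = ?r (Bar (s \<otimes> w))" for s w
  proof (rule additive_tensor_eqI[THEN fun_cong, where x = s])
    show "?l (Bar ((x + y) \<otimes> w)) = ?l (Bar (x \<otimes> w)) + ?l (Bar (y \<otimes> w))" for x y
      by (simp only: tens_simps Bar_simps clinear_add[OF l])
    show "?r (Bar ((x + y) \<otimes> w)) = ?r (Bar (x \<otimes> w)) + ?r (Bar (y \<otimes> w))" for x y
      by (simp only: tens_simps Bar_simps clinear_add[OF r])
    show "?l (Bar ((u \<otimes> v) \<otimes> w)) = ?r (Bar ((u \<otimes> v) \<otimes> w))" for u v
      by (simp add: conj_map_Bar tensor_assoc_tens rho_Bar tensor_map_tens clinear_rho clinear_id)
  qed
qed

theorem proposition4p8: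
  fixes \<Delta> :: "'h::complex_algebra_1 \<Rightarrow> 'h \<otimes> 'h"
    and \<epsilon> :: "'h \<Rightarrow> complex"
    and S :: "'h \<Rightarrow> 'h"
    and star :: "'h \<Rightarrow> 'h"
  assumes "hopf_star_algebra \<Delta> \<epsilon> S star"
  shows
    "(\<forall>(actV :: 'h \<Rightarrow> 'v::complex_vector \<Rightarrow> 'v) (actW :: 'h \<Rightarrow> 'w::complex_vector \<Rightarrow> 'w).
        hmodule actV \<longrightarrow> hmodule actW \<longrightarrow>
        (\<forall>v w. (rho :: ('v \<otimes> 'w) conj_space \<Rightarrow> _) (Bar (v \<otimes> w)) = Bar w \<otimes> Bar v) \<and>
        hmodule_iso
          (conj_act S star (tensor_act \<Delta> actV actW))
          (tensor_act \<Delta> (conj_act S star actW) (conj_act S star actV))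
          (rho :: ('v \<otimes> 'w) conj_space \<Rightarrow> 'w conj_space \<otimes> 'v conj_space))
     \<and>
     (\<forall>(actW :: 'h \<Rightarrow> 'w \<Rightarrow> 'w) (actX :: 'h \<Rightarrow> 'x::complex_vector \<Rightarrow> 'x)
        (actY :: 'h \<Rightarrow> 'y::complex_vector \<Rightarrow> 'y) (actZ :: 'h \<Rightarrow> 'z::complex_vector \<Rightarrow> 'z) P T.
        hmodule actW \<longrightarrow> hmodule actX \<longrightarrow> hmodule actY \<longrightarrow> hmodule actZ \<longrightarrow>
        hmodule_hom actW actY P \<longrightarrow> hmodule_hom actX actZ T \<longrightarrow>
        (rho :: ('y \<otimes> 'z) conj_space \<Rightarrow> 'z conj_space \<otimes> 'y conj_space) \<circ>
          conj_map (tensor_map P T) =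
        tensor_map (conj_map T) (conj_map P) \<circ>
          (rho :: ('w \<otimes> 'x) conj_space \<Rightarrow> 'x conj_space \<otimes> 'w conj_space))
     \<and>
     (\<forall>(actU :: 'h \<Rightarrow> 'u::complex_vector \<Rightarrow> 'u) (actV :: 'h \<Rightarrow> 'v \<Rightarrow> 'v) (actW :: 'h \<Rightarrow> 'w \<Rightarrow> 'w).
        hmodule actU \<longrightarrow> hmodule actV \<longrightarrow> hmodule actW \<longrightarrow>
        tensor_assoc \<circ>
          tensor_map (rho :: ('v \<otimes> 'w) conj_space \<Rightarrow> _) (id :: 'u conj_space \<Rightarrow> _) \<circ>
          (rho :: ('u \<otimes> ('v \<otimes> 'w)) conj_space \<Rightarrow> _) \<circ> conj_map tensor_assoc =
        tensor_map (id :: 'w conj_space \<Rightarrow> _) (rho :: ('u \<otimes> 'v) conj_space \<Rightarrow> _) \<circ>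
          (rho :: (('u \<otimes> 'v) \<otimes> 'w) conj_space \<Rightarrow> _))"
proof -
  interpret hopf_star_algebra \<Delta> \<epsilon> S star by fact
  show ?thesis
    by (auto simp: rho_Bar hmodule_iso_rho rho_assoc hmodule_hom.clinear_hom rho_natural)
qed

end
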